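(* For every integer $n\geq 1$ with $n\not\equiv 2 \pmod 4$, $c_5(n)=c_6(n)$, where $c_5(n)=|\mathcal C_n^{++-}|$ and $c_6(n)=|\mathcal C_n^{+--}|$; thus the signatures $++-$ and $+--$ are weakly c-Wilf-equivalent.
   Context: $\mathcal S_n$ is the set of permutations of $[n]$ in one-line notation $\pi=\pi_1\cdots\pi_n$; $\mathcal C_n$ is the set of cyclic permutations (single $n$-cycle) in $\mathcal S_n$. For $\sigma=\sigma^0\cdots\sigma^{k-1}\in\{+,-\}^k$, $\mathcal S^\sigma_n$ is the set of $\pi\in\mathcal S_n$ for which there exist $0=e_0\le e_1\le\cdots\le e_k=n$ with each segment $\pi_{e_i+1}\cdots\pi_{e_{i+1}}$ increasing if $\sigma^i=+$ and decreasing if $\sigma^i=-$; $\mathcal C_n^\sigma=\mathcal C_n\cap\mathcal S_n^\sigma$. Two signatures are weakly c-Wilf-equivalent if for every $n\not\equiv 2\pmod 4$ they have equally many cyclic permutations of length $n$ in their classes. *)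

theory Defs
  imports "HOL-Combinatorics.Permutations"
begin

text \<open>A permutation of [n] in one-line notation pi_1 ... pi_n is represented by a
function p with p permutes {1..n}; pi_i = p i.\<close>

definition cyclic_perm :: "nat \<Rightarrow> (nat \<Rightarrow> nat) \<Rightarrow> bool" where
  "cyclic_perm n p \<longleftrightarrow> p permutes {1..n} \<and> {(p ^^ k) 1 | k. True} = {1..n}"

text \<open>Signature sigma in {+,-}^k as a bool list (True = +, False = -).
  p is in S_n^sigma iff there exist 0 = e_0 <= e_1 <= ... <= e_k = n such that each
  segment pi_(e_i+1) ... pi_(e_(i+1)) is increasing (+) or decreasing (-).\<close>
definition in_sig_class :: "bool list \<Rightarrow> nat \<Rightarrow> (nat \<Rightarrow> nat) \<Rightarrow> bool" where
  "in_sig_class \<sigma> n p \<longleftrightarrow> p permutes {1..n} \<and>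
     (\<exists>e :: nat \<Rightarrow> nat. e 0 = 0 \<and> e (length \<sigma>) = n \<and>
        (\<forall>i < length \<sigma>. e i \<le> e (Suc i)) \<and>
        (\<forall>i < length \<sigma>. \<forall>a b. e i < a \<and> a < b \<and> b \<le> e (Suc i) \<longrightarrow>
            (if \<sigma> ! i then p a < p b else p a > p b)))"

definition cyc_class :: "bool list \<Rightarrow> nat \<Rightarrow> (nat \<Rightarrow> nat) set" where
  "cyc_class \<sigma> n = {p. cyclic_perm n p \<and> in_sig_class \<sigma> n p}"

end

theory Submission
  imports Defs Complex_Main "HOL-Library.Multiset"
begin

text \<open>
  Given a subset S of \<open>{1..<n}\<close>, label each position by the block of the composition of n determined
  by S. Reading labels along the cycle (the bijection of Gessel and Reutenauer) turns a cyclic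
  permutation that is increasing on every block, with a starting point, into a primitive n-periodic
  word with prescribed letter multiplicities, and this is bijective. The same holds for cyclic
  permutations that are decreasing on every block, because a non-primitive word could only be a
  square qq with |q| odd, which is impossible for \<open>n mod 4 \<noteq> 2\<close>. Hence \<open>{p. Des p \<subseteq> S}\<close> and
  \<open>{p. Des (p \<circ> flip) \<subseteq> S}\<close> contain equally many cyclic permutations, where flip is
  \<open>i \<mapsto> n + 1 - i\<close>; by inclusion-exclusion so do \<open>{p. Des p = S}\<close> and \<open>{p. Des (p \<circ> flip) = S}\<close>.
  Membership in the class of ++- only depends on the descent set, and p lies in the class of +-- iff
  \<open>p \<circ> flip\<close> lies in that of ++-.
\<close>

subsection \<open>Orbits of cyclic permutations\<close>

text \<open>By pigeonhole the orbit of 1 returns to its start; with least return time N it is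
  N-periodic and injective on its first N terms. Since it fills \<open>{1..n}\<close>, N = n. Any
  other start \<open>x\<close> is a shift along this orbit.\<close>

lemma cyclic_perm_funpow_eq_iff:
  assumes "cyclic_perm n p" "n \<ge> 1" "x \<in> {1..n}"
  shows "(p ^^ i) x = (p ^^ j) x \<longleftrightarrow> i mod n = j mod n"
proof -
  define y where "y i = (p ^^ i) 1" for i
  have perm: "p permutes {1..n}" and range: "range y = {1..n}"
    using assms(1) by (auto simp: cyclic_perm_def y_def)
  have "inj (p ^^ i)" for i
    using perm by (intro inj_fn permutes_inj)
  then have shift: "y (k + i) = y (k + j) \<longleftrightarrow> y i = y j" for k i j
    by (simp add: y_def funpow_add inj_eq)
  have "\<not> inj y"
    using range by (metis finite_atLeastAtMost finite_imageD infinite_UNIV_nat)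
  then obtain a b where "a < b" "y a = y b"
    by (metis injI linorder_neqE_nat)
  then have "y (b - a) = y 0" "0 < b - a"
    using shift[of a "b - a" 0] by auto
  then have ex: "\<exists>N>0. y N = y 0" by blast
  define N where "N = (LEAST N. N > 0 \<and> y N = y 0)"
  have N: "N > 0" "y N = y 0" and least: "\<And>k. k > 0 \<Longrightarrow> y k = y 0 \<Longrightarrow> N \<le> k"
    using LeastI_ex[OF ex] by (auto simp: N_def intro: Least_le)
  have add: "y (k + N) = y k" for k
    using shift[of k N 0] N by simp
  have "y (k + q * N) = y k" for k q
  proof (induction q)
    case (Suc q)
    then show ?case
      using add[of "k + q * N"] by (simp add: ac_simps)
  qed simp
  then have ymod: "y k = y (k mod N)" for k
    by (metis mod_div_mult_eq)
  have less: "u = v" if "u \<le> v" "v < N" "y u = y v" for u v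
  proof (rule ccontr)
    assume "u \<noteq> v"
    then have "0 < v - u" "y (v - u) = y 0"
      using shift[of u "v - u" 0] that by auto
    then show False using least[of "v - u"] that(2) by linarith
  qed
  then have inj: "inj_on y {..<N}"
    by (intro inj_onI) (metis lessThan_iff linear)
  have "y k \<in> y ` {..<N}" for k
    using ymod[of k] N(1) by (intro image_eqI[of _ _ "k mod N"]) auto
  then have "range y = y ` {..<N}" by auto
  then have "N = n"
    using range card_image[OF inj] by (metis card_atLeastAtMost card_lessThan diff_Suc_1)
  have eq: "y i = y j \<longleftrightarrow> i mod n = j mod n" for i j
    using inj_on_eq_iff[OF inj, of "i mod N" "j mod N"] ymod[of i] ymod[of j] N(1) \<open>N = n\<close> by auto
  have "x \<in> range y" using assms(3) range by blast
  then obtain m where "x = y m" by blast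
  then have "(p ^^ i) x = y (m + i)" for i
    by (simp add: y_def funpow_add add.commute[of m])
  then show ?thesis using shift eq by simp
qed

lemma cyclic_perm_orbit_bij:
  assumes "cyclic_perm n p" "n \<ge> 1" "x \<in> {1..n}"
  shows "bij_betw (\<lambda>i. (p ^^ i) x) {..<n} {1..n}"
proof -
  have perm: "p permutes {1..n}"
    using assms(1) by (simp add: cyclic_perm_def)
  have "(p ^^ i) x \<in> {1..n}" for i
    using assms(3) permutes_in_image[OF perm] by (induction i) auto
  moreover have inj: "inj_on (\<lambda>i. (p ^^ i) x) {..<n}"
    by (intro inj_onI) (simp add: cyclic_perm_funpow_eq_iff[OF assms])
  ultimately show ?thesis
    by (intro bij_betw_imageI card_subset_eq) (auto simp: card_image)
qed

subsection \<open>Itineraries\<close>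

text \<open>If y i is the position of the i-th point of an orbit and w i the letter of that position, then
  the letters grow (r = 1) or fall (r = -1) with the position, and the permutation is increasing
  (s = 1) or decreasing (s = -1) on each block of equal letters.\<close>

definition itinerary :: "int \<Rightarrow> real \<Rightarrow> (nat \<Rightarrow> int) \<Rightarrow> (nat \<Rightarrow> real) \<Rightarrow> bool" where
  "itinerary r s w y \<longleftrightarrow> (\<forall>i j. r * w i < r * w j \<longrightarrow> y i < y j) \<and>
     (\<forall>i j. w i = w j \<longrightarrow> (y i < y j \<longleftrightarrow> s * y (Suc i) < s * y (Suc j)))"

text \<open>Where the letters differ, they decide the order; as long as they agree, the order is
  carried one step along the orbit, up to the sign \<open>s\<close>. So the word alone determines
  the order of two points whose tails differ somewhere.\<close>

lemma itinerary_unique: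
  assumes y: "itinerary r s w y" and z: "itinerary r s w z"
    and r: "r \<noteq> 0" and s: "s = 1 \<or> s = -1" and "w (i + m) \<noteq> w (j + m)"
  shows "y i < y j \<longleftrightarrow> z i < z j"
  using assms(5)
proof (induction m arbitrary: i j)
  case 0
  then have "r * w i < r * w j \<or> r * w j < r * w i"
    using r by (simp add: linorder_neq_iff[symmetric])
  then show ?case
    using y z unfolding itinerary_def by (meson less_asym)
next
  case (Suc m)
  show ?case
  proof (cases "w i = w j")
    case True
    have "y (Suc i) < y (Suc j) \<longleftrightarrow> z (Suc i) < z (Suc j)"
      "y (Suc j) < y (Suc i) \<longleftrightarrow> z (Suc j) < z (Suc i)"
      using Suc.IH[of "Suc i" "Suc j"] Suc.IH[of "Suc j" "Suc i"] Suc.prems by auto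
    moreover have "y i < y j \<longleftrightarrow> s * y (Suc i) < s * y (Suc j)"
      "z i < z j \<longleftrightarrow> s * z (Suc i) < s * z (Suc j)"
      using y z True unfolding itinerary_def by blast+
    ultimately show ?thesis using s by auto
  next
    case False
    then have "r * w i < r * w j \<or> r * w j < r * w i"
      using r by (simp add: linorder_neq_iff[symmetric])
    then show ?thesis
      using y z unfolding itinerary_def by (meson less_asym)
  qed
qed

text \<open>The positions are realised by the orbit of a piecewise affine map whose branches have slope
  s * b, i.e. by the signed base b expansions with digits r * w i.\<close>

lemma itinerary_exists:
  fixes w :: "nat \<Rightarrow> int"
  assumes bounded: "\<And>i. \<bar>w i\<bar> \<le> M" and r: "r = 1 \<or> r = -1" and s: "s = 1 \<or> s = -1"
  obtains y where "itinerary r s w y" "\<And>i j. y i = y j \<longleftrightarrow> (\<forall>m. w (i + m) = w (j + m))"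
proof -
  have M: "M \<ge> 0" using bounded[of 0] by simp
  \<comment> \<open>With digits bounded by M, the base 2M + 2 keeps every expansion below M / (2M +
    1) < 1/2 in absolute value, so tails can never compensate a difference of 1 in the leading
    digit.\<close>
  define b :: real where "b = 2 * real_of_int M + 2"
  have b: "b \<ge> 2" using M by (simp add: b_def)
  define f where "f i m = s ^ m * (r * w (i + m)) / b ^ Suc m" for i m
  define y where "y i = suminf (f i)" for i
  have abs_sr: "\<bar>s\<bar> = 1" "\<bar>real_of_int r\<bar> = 1" using r s by auto
  have geom: "(\<lambda>m. M * (1 / b) ^ Suc m) sums (M / (b - 1))"
  proof -
    have "(\<lambda>m. (M / b) * (1 / b) ^ m) sums ((M / b) * (1 / (1 - 1 / b)))"
      using b by (intro sums_mult geometric_sums) auto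
    moreover have "(M / b) * (1 / (1 - 1 / b)) = M / (b - 1)"
      using b by (simp add: field_simps)
    moreover have "(\<lambda>m. M * (1 / b) ^ Suc m) = (\<lambda>m. (M / b) * (1 / b) ^ m)"
      by simp
    ultimately show ?thesis by (simp only:)
  qed
  have f_le: "\<bar>f i m\<bar> \<le> M * (1 / b) ^ Suc m" for i m
  proof -
    have "\<bar>f i m\<bar> = \<bar>w (i + m)\<bar> / b ^ Suc m"
      using b abs_sr by (simp add: f_def abs_mult power_abs)
    also have "\<dots> \<le> M / b ^ Suc m"
      using bounded[of "i + m"] b by (intro divide_right_mono) auto
    finally show ?thesis by (simp add: power_one_over field_simps)
  qed
  have summable_abs: "summable (\<lambda>m. \<bar>f i m\<bar>)" for i
    using f_le by (intro summable_comparison_test'[OF sums_summable[OF geom], of 0]) auto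
  have summable: "summable (f i)" for i
    using summable_abs by (rule summable_rabs_cancel)
  have y_bound: "\<bar>y i\<bar> < 1 / 2" for i
  proof -
    have "\<bar>y i\<bar> \<le> (\<Sum>m. \<bar>f i m\<bar>)"
      unfolding y_def by (rule summable_rabs[OF summable_abs])
    also have "\<dots> \<le> M / (b - 1)"
      using suminf_le[OF f_le summable_abs sums_summable[OF geom]] sums_unique[OF geom] by simp
    also have "\<dots> < 1 / 2"
      using M by (simp add: b_def field_simps)
    finally show ?thesis .
  qed
  \<comment> \<open>Multiplying by \<open>b\<close> strips the leading digit; the remaining tail
    changes sign when s = -1.\<close>
  have y_step: "b * y i = r * w i + s * y (Suc i)" for i
  proof -
    have "f i (Suc m) = s / b * f (Suc i) m" for m
      by (simp add: f_def)
    then have "suminf (f i) = f i 0 + s / b * suminf (f (Suc i))"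
      using suminf_split_head[OF summable, of i] suminf_mult[OF summable, of "s / b" "Suc i"]
      by simp
    then show ?thesis
      using b by (simp add: y_def f_def field_simps)
  qed
  have lt: "y i < y j" if "r * w i < r * w j" for i j
  proof -
    have "real_of_int (r * w i) + 1 \<le> real_of_int (r * w j)"
      using that by linarith
    moreover have "\<bar>s * y k\<bar> < 1 / 2" for k
      using y_bound[of k] by (simp add: abs_mult abs_sr)
    ultimately have "b * y i < b * y j"
      unfolding y_step of_int_mult[symmetric] by (smt (verit) field_sum_of_halves)
    then show ?thesis using b by simp
  qed
  have eq: "y i < y j \<longleftrightarrow> s * y (Suc i) < s * y (Suc j)" if "w i = w j" for i j
  proof -
    have "y i < y j \<longleftrightarrow> b * y i < b * y j" using b by simp
    then show ?thesis by (simp add: y_step that)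
  qed
  have itin: "itinerary r s w y"
    using lt eq by (simp add: itinerary_def)
  \<comment> \<open>Equal values have equal leading digits by \<open>lt\<close>, hence equal tails
    by \<open>y_step\<close>; induction then reads off all digits.\<close>
  have "w (i + m) = w (j + m)" if "y i = y j" for i j m
    using that
  proof (induction m arbitrary: i j)
    case 0
    then show ?case
      using lt[of i j] lt[of j i] r by (cases "w i" "w j" rule: linorder_cases) auto
  next
    case (Suc m)
    have "w i = w j"
      using lt[of i j] lt[of j i] r Suc.prems by (cases "w i" "w j" rule: linorder_cases) auto
    then have "s * y (Suc i) = s * y (Suc j)"
      using y_step[of i] y_step[of j] Suc.prems by auto
    then have "y (Suc i) = y (Suc j)" using s by auto
    then show ?case using Suc.IH[of "Suc i" "Suc j"] by simp
  qed
  moreover have "y i = y j" if "\<forall>m. w (i + m) = w (j + m)" for i j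
  proof -
    have "f i = f j" using that by (simp add: f_def fun_eq_iff)
    then show ?thesis by (simp add: y_def)
  qed
  ultimately show thesis
    using that itin by blast
qed


subsection \<open>Primitive words\<close>

text \<open>Words of length n are kept as n-periodic functions, so that shifts need no reduction mod
  n. Excluding periods \<open>d\<close> below n says that the word is not a proper power.\<close>

definition primitive_words :: "nat \<Rightarrow> (nat \<Rightarrow> int) \<Rightarrow> (nat \<Rightarrow> int) set" where
  "primitive_words n l = {w. (\<forall>i. w (i + n) = w i) \<and>
     (\<forall>d. 0 < d \<and> d < n \<longrightarrow> (\<exists>i. w (i + d) \<noteq> w i)) \<and>
     image_mset w (mset_set {..<n}) = image_mset l (mset_set {1..n})}"

text \<open>The real sign \<open>s\<close> treats increasing (1) and decreasing (-1) blocks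
  uniformly.\<close>

definition block_monotone :: "nat \<Rightarrow> real \<Rightarrow> (nat \<Rightarrow> int) \<Rightarrow> (nat \<Rightarrow> nat) \<Rightarrow> bool" where
  "block_monotone n s l p \<longleftrightarrow>
     (\<forall>a b. 1 \<le> a \<and> a < b \<and> b \<le> n \<and> l a = l b \<longrightarrow> s * real (p a) < s * real (p b))"

lemma periodic_mod:
  fixes w :: "nat \<Rightarrow> 'a"
  assumes "\<And>i. w (i + n) = w i"
  shows "w i = w (i mod n)"
proof -
  have "w (k + q * n) = w k" for k q
  proof (induction q)
    case (Suc q)
    then show ?case
      using assms[of "k + q * n"] by (simp add: ac_simps)
  qed simp
  then show ?thesis by (metis mod_div_mult_eq)
qed

text \<open>By periodicity, agreement of two tails extends to the whole word, so the difference of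
  the starting indices mod n is a period; primitivity forces it to be 0.\<close>

lemma primitive_words_tail_eqD:
  assumes w: "w \<in> primitive_words n l" and "n \<ge> 1" and "\<And>m. w (i + m) = w (j + m)"
  shows "i mod n = j mod n"
proof -
  have wmod: "w k = w (k mod n)" for k
    using w by (intro periodic_mod) (simp add: primitive_words_def)
  have *: "i mod n = j mod n" if "i \<le> j" and tail: "\<And>m. w (i + m) = w (j + m)" for i j
  proof -
    define d where "d = (j - i) mod n"
    have "w (k + d) = w k" for k
    proof -
      \<comment> \<open>Adding \<open>n * i\<close>, a multiple of n that is at least
        \<open>i\<close>, moves any index \<open>k\<close> far enough to lie in the tails being
        compared.\<close>
      have "i \<le> n * i" using \<open>n \<ge> 1\<close> by simp
      have "w (k + d) = w (k + (j - i))"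
        using wmod[of "k + d"] wmod[of "k + (j - i)"] by (simp add: d_def mod_simps)
      also have "\<dots> = w (k + (j - i) + n * i)"
        using wmod[of "k + (j - i) + n * i"] wmod[of "k + (j - i)"] by simp
      also have "\<dots> = w (j + (k + (n * i - i)))"
        using \<open>i \<le> j\<close> \<open>i \<le> n * i\<close> by (intro arg_cong[of _ _ w]) linarith
      also have "\<dots> = w (i + (k + (n * i - i)))"
        by (rule tail[symmetric])
      also have "\<dots> = w (k + n * i)"
        using \<open>i \<le> n * i\<close> by (intro arg_cong[of _ _ w]) linarith
      also have "\<dots> = w k"
        using wmod[of "k + n * i"] wmod[of k] by simp
      finally show ?thesis .
    qed
    moreover have "d < n" using \<open>n \<ge> 1\<close> by (simp add: d_def)
    ultimately have "d = 0"
      using w by (auto simp: primitive_words_def)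
    then have "n dvd j - i" by (simp add: d_def mod_eq_0_iff_dvd)
    then show ?thesis
      using \<open>i \<le> j\<close> by (metis mod_eq_dvd_iff_nat)
  qed
  show ?thesis
  proof (cases "i \<le> j")
    case True
    then show ?thesis using *[of i j] assms(3) by simp
  next
    case False
    then show ?thesis using *[of j i] assms(3) by simp
  qed
qed

lemma cyclic_perm_itinerary:
  assumes cyc: "cyclic_perm n p" and "n \<ge> 1" and x: "x \<in> {1..n}"
    and mono: "\<And>a b. 1 \<le> a \<Longrightarrow> a < b \<Longrightarrow> b \<le> n \<Longrightarrow> r * l a \<le> r * l b"
    and block: "block_monotone n s l p"
  shows "itinerary r s (\<lambda>i. l ((p ^^ i) x)) (\<lambda>i. real ((p ^^ i) x))"
proof -
  define y where "y i = (p ^^ i) x" for i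
  have y_in: "1 \<le> y i" "y i \<le> n" for i
  proof -
    have "y i \<in> {1..n}"
      using x cyc unfolding y_def cyclic_perm_def by (induction i) (auto dest: permutes_in_image)
    then show "1 \<le> y i" "y i \<le> n" by auto
  qed
  have y_Suc: "y (Suc i) = p (y i)" for i by (simp add: y_def)
  have "y i < y j" if "r * l (y i) < r * l (y j)" for i j
    using mono[of "y j" "y i"] y_in that by (cases "y i" "y j" rule: linorder_cases) auto
  moreover have "y i < y j \<longleftrightarrow> s * y (Suc i) < s * y (Suc j)" if "l (y i) = l (y j)" for i j
  proof -
    have "y i < y j \<Longrightarrow> s * y (Suc i) < s * y (Suc j)"
      "y j < y i \<Longrightarrow> s * y (Suc j) < s * y (Suc i)"
      using block y_in that unfolding block_monotone_def y_Suc by auto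
    then show ?thesis
      by (cases "y i" "y j" rule: linorder_cases) (auto simp: y_Suc)
  qed
  ultimately show ?thesis by (simp add: itinerary_def y_def)
qed

text \<open>A word of period d \<open><\<close> n would make the orbit move monotonically under the d-th iterate,
  unless that iterate reverses the order; then the same applies to the 2d-th iterate, unless n = 2d.\<close>

lemma itinerary_word_primitive:
  assumes cyc: "cyclic_perm n p" and "n \<ge> 1" and n: "n mod 4 \<noteq> 2" and x: "x \<in> {1..n}"
    and s: "s = 1 \<or> s = -1" and d: "0 < d" "d < n"
    and itin: "itinerary r s w (\<lambda>i. real ((p ^^ i) x))"
  shows "\<exists>i. w (i + d) \<noteq> w i"
proof (rule ccontr)
  assume "\<not> (\<exists>i. w (i + d) \<noteq> w i)"
  then have per: "w (i + d) = w i" for i by simp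
  define y where "y i = real ((p ^^ i) x)" for i
  have y_eq: "y i = y j \<longleftrightarrow> i mod n = j mod n" for i j
    using cyclic_perm_funpow_eq_iff[OF cyc \<open>n \<ge> 1\<close> x] by (simp add: y_def)
  have no_period: False if per: "\<And>i. w (i + e) = w i" and e: "s ^ e = 1" "\<not> n dvd e" for e
  proof -
    have step: "y i < y (i + e) \<longleftrightarrow> s * y (Suc i) < s * y (Suc i + e)"
      "y (i + e) < y i \<longleftrightarrow> s * y (Suc i + e) < s * y (Suc i)" for i
      using itin per[of i] unfolding itinerary_def y_def by auto
    \<comment> \<open>Each step along the orbit contributes one factor \<open>s\<close> to the
      comparison, so after \<open>e\<close> steps the direction is unchanged exactly because
      \<open>s ^ e = 1\<close>. The points at multiples of \<open>e\<close> therefore move strictly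
      one way, yet index \<open>n * e\<close> is back at the start.\<close>
    have steps: "y i < y (i + e) \<longleftrightarrow> s ^ k * y (i + k) < s ^ k * y (i + k + e)" for i k
    proof (induction k)
      case (Suc k)
      have "s ^ k = 1 \<or> s ^ k = -1" using s by (induction k) auto
      then show ?case using Suc step[of "i + k"] s by auto
    qed simp
    have steps_e: "y i < y (i + e) \<longleftrightarrow> y (i + e) < y (i + e + e)" for i
      using steps[of i e] e by simp
    have all: "y (k * e) < y (k * e + e) \<longleftrightarrow> y 0 < y e" for k
    proof (induction k)
      case (Suc k)
      then show ?case using steps_e[of "k * e"] by (simp add: ac_simps)
    qed simp
    have ne: "y (k * e) \<noteq> y (k * e + e)" for k
    proof
      assume "y (k * e) = y (k * e + e)"
      then have "n dvd (k * e + e) - k * e"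
        unfolding y_eq by (metis le_add1 mod_eq_dvd_iff_nat)
      then show False using e by simp
    qed
    have yn: "y (n * e) = y 0" using y_eq by simp
    show False
    proof (cases "y 0 < y e")
      case True
      then have "strict_mono (\<lambda>k. y (k * e))"
        using all by (auto simp: strict_mono_Suc_iff ac_simps)
      then have "y (0 * e) < y (n * e)"
        using \<open>n \<ge> 1\<close> by (intro strict_monoD[of "\<lambda>k. y (k * e)"]) auto
      then show False using yn by simp
    next
      case False
      then have "y (k * e + e) < y (k * e)" for k
        using all[of k] ne[of k] by linarith
      then have "strict_mono (\<lambda>k. - y (k * e))"
        by (auto simp: strict_mono_Suc_iff ac_simps)
      then have "- y (0 * e) < - y (n * e)"
        using \<open>n \<ge> 1\<close> by (intro strict_monoD[of "\<lambda>k. - y (k * e)"]) auto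
      then show False using yn by simp
    qed
  qed
  show False
  proof (cases "s ^ d = 1")
    case True
    moreover have "\<not> n dvd d" using d by (auto dest: dvd_imp_le)
    ultimately show False using no_period per by blast
  next
    case False
    then have "odd d" and s: "s = -1" using s by auto
    \<comment> \<open>As 0 < d < n, divisibility would force n = 2d; with \<open>d\<close> odd this
      means n mod 4 = 2.\<close>
    have "\<not> n dvd d + d"
    proof
      assume "n dvd d + d"
      then obtain k where k: "d + d = n * k" ..
      have "k < 2"
      proof (rule ccontr)
        assume "\<not> k < 2"
        then have "n * 2 \<le> n * k" by (intro mult_le_mono2) simp
        then show False using k d by linarith
      qed
      then have "n = 2 * d" using k d by (cases k) auto
      moreover obtain b where "d = 2 * b + 1" using \<open>odd d\<close> by (elim oddE)
      ultimately show False using n by presburger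
    qed
    moreover have "w (i + (d + d)) = w i" for i
      using per[of i] per[of "i + d"] by (simp add: ac_simps)
    moreover have "s ^ (d + d) = 1" using s by simp
    ultimately show False using no_period by blast
  qed
qed

text \<open>A weakly increasing labelling lists its values in sorted order and is thus determined by
  their multiset; the factor \<open>r\<close> reduces the decreasing case to this one.\<close>

lemma monotone_content_unique:
  fixes u v :: "nat \<Rightarrow> int"
  assumes r: "r = 1 \<or> r = -1"
    and u: "\<And>a b. 1 \<le> a \<Longrightarrow> a < b \<Longrightarrow> b \<le> n \<Longrightarrow> r * u a \<le> r * u b"
    and v: "\<And>a b. 1 \<le> a \<Longrightarrow> a < b \<Longrightarrow> b \<le> n \<Longrightarrow> r * v a \<le> r * v b"
    and content: "image_mset u (mset_set {1..n}) = image_mset v (mset_set {1..n})"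
    and z: "z \<in> {1..n}"
  shows "u z = v z"
proof -
  have mset: "mset (map (\<lambda>z. r * t z) [1..<Suc n]) =
      image_mset ((*) r) (image_mset t (mset_set {1..n}))" for t :: "nat \<Rightarrow> int"
    by (simp add: multiset.map_comp comp_def atLeastLessThanSuc_atLeastAtMost del: upt_Suc)
  have sorted: "sorted (map (\<lambda>z. r * t z) [1..<Suc n])"
    if "\<And>a b. 1 \<le> a \<Longrightarrow> a < b \<Longrightarrow> b \<le> n \<Longrightarrow> r * t a \<le> r * t b" for t :: "nat \<Rightarrow> int"
    unfolding sorted_wrt_map
    by (rule sorted_wrt_mono_rel[OF _ sorted_wrt_upt]) (use that in \<open>simp del: upt_Suc\<close>)
  have "mset (map (\<lambda>z. r * u z) [1..<Suc n]) = mset (map (\<lambda>z. r * v z) [1..<Suc n])"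
    unfolding mset content ..
  moreover have "sorted (map (\<lambda>z. r * u z) [1..<Suc n])" "sorted (map (\<lambda>z. r * v z) [1..<Suc n])"
    using u v by (blast intro: sorted)+
  ultimately have "map (\<lambda>z. r * u z) [1..<Suc n] = map (\<lambda>z. r * v z) [1..<Suc n]"
    using properties_for_sort sorted_sort_id by metis
  then have "\<forall>z\<in>{1..n}. r * u z = r * v z"
    by (simp add: atLeastLessThanSuc_atLeastAtMost del: upt_Suc)
  then show ?thesis using z r by auto
qed

section \<open>Bijection between cyclic permutations with a starting point and primitive
  words\<close>

context
  fixes n :: nat and r :: int and s :: real and l :: "nat \<Rightarrow> int"
  assumes n: "n \<ge> 1" "n mod 4 \<noteq> 2" and r: "r = 1 \<or> r = -1" and s: "s = 1 \<or> s = -1"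
    and mono: "\<And>a b. 1 \<le> a \<Longrightarrow> a < b \<Longrightarrow> b \<le> n \<Longrightarrow> r * l a \<le> r * l b"
begin

lemma itinerary_word_in_primitive_words:
  assumes cyc: "cyclic_perm n p" and block: "block_monotone n s l p" and x: "x \<in> {1..n}"
  shows "(\<lambda>i. l ((p ^^ i) x)) \<in> primitive_words n l"
proof -
  note itin = cyclic_perm_itinerary[OF cyc n(1) x mono block]
  have "(p ^^ (i + n)) x = (p ^^ i) x" for i
    by (simp add: cyclic_perm_funpow_eq_iff[OF cyc n(1) x])
  moreover have "image_mset (\<lambda>i. l ((p ^^ i) x)) (mset_set {..<n}) = image_mset l (mset_set {1..n})"
  proof -
    note bij = cyclic_perm_orbit_bij[OF cyc n(1) x]
    have "image_mset (\<lambda>i. (p ^^ i) x) (mset_set {..<n}) = mset_set {1..n}"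
      using image_mset_mset_set[OF bij_betw_imp_inj_on[OF bij]] bij_betw_imp_surj_on[OF bij] by simp
    then have "image_mset l (image_mset (\<lambda>i. (p ^^ i) x) (mset_set {..<n})) =
        image_mset l (mset_set {1..n})" by (rule arg_cong)
    then show ?thesis
      by (simp only: multiset.map_comp comp_def)
  qed
  ultimately show ?thesis
    using itinerary_word_primitive[OF cyc n x s _ _ itin] by (simp add: primitive_words_def)
qed

text \<open>Distinct orbit points have different tails by primitivity, so the word fixes the
  relative order of the whole orbit. As the orbit fills \<open>{1..n}\<close>, each point is
  recovered from its rank.\<close>

lemma itinerary_word_inj:
  assumes p: "cyclic_perm n p" "block_monotone n s l p" "x \<in> {1..n}"
    and q: "cyclic_perm n q" "block_monotone n s l q" "z \<in> {1..n}"
    and eq: "(\<lambda>i. l ((p ^^ i) x)) = (\<lambda>i. l ((q ^^ i) z))"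
  shows "p = q \<and> x = z"
proof -
  define w where "w i = l ((p ^^ i) x)" for i
  have w: "w \<in> primitive_words n l"
    using itinerary_word_in_primitive_words[OF p] by (simp add: w_def[abs_def])
  have itin: "itinerary r s w (\<lambda>i. real ((p ^^ i) x))" "itinerary r s w (\<lambda>i. real ((q ^^ i) z))"
    using cyclic_perm_itinerary[OF p(1) n(1) p(3) mono p(2)]
      cyclic_perm_itinerary[OF q(1) n(1) q(3) mono q(2)] eq
    by (simp_all add: w_def[abs_def])
  have order: "(p ^^ i) x < (p ^^ j) x \<longleftrightarrow> (q ^^ i) z < (q ^^ j) z" for i j
  proof (cases "i mod n = j mod n")
    case True
    then show ?thesis
      using cyclic_perm_funpow_eq_iff[OF p(1) n(1) p(3), of i j]
        cyclic_perm_funpow_eq_iff[OF q(1) n(1) q(3), of i j] by simp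
  next
    case False
    then obtain m where "w (i + m) \<noteq> w (j + m)"
      using primitive_words_tail_eqD[OF w n(1)] by blast
    then show ?thesis
      using itinerary_unique[OF itin _ s] r by auto
  qed
  have rank: "(p ^^ i) x = Suc (card {j \<in> {..<n}. (p ^^ j) x < (p ^^ i) x})"
    if p: "cyclic_perm n p" "x \<in> {1..n}" for p x i
  proof -
    note bij = cyclic_perm_orbit_bij[OF p(1) n(1) p(2)]
    have in_range: "(p ^^ i) x \<in> {1..n}"
      using p permutes_in_image[of p "{1..n}"] unfolding cyclic_perm_def by (induction i) auto
    have "(\<lambda>j. (p ^^ j) x) ` {j \<in> {..<n}. (p ^^ j) x < (p ^^ i) x} =
        {y \<in> (\<lambda>j. (p ^^ j) x) ` {..<n}. y < (p ^^ i) x}" by auto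
    also have "\<dots> = {1..<(p ^^ i) x}"
      using in_range unfolding bij_betw_imp_surj_on[OF bij] by auto
    finally have "card {j \<in> {..<n}. (p ^^ j) x < (p ^^ i) x} = card {1..<(p ^^ i) x}"
      by (metis (no_types, lifting) card_image inj_on_subset[OF bij_betw_imp_inj_on[OF bij]]
          mem_Collect_eq subsetI)
    then show ?thesis using in_range by simp
  qed
  have orbit_eq: "(p ^^ i) x = (q ^^ i) z" for i
    using rank[OF p(1,3), of i] rank[OF q(1,3), of i] order by simp
  have "p y = q y" for y
  proof (cases "y \<in> {1..n}")
    case True
    then obtain i where "y = (p ^^ i) x"
      using bij_betw_imp_surj_on[OF cyclic_perm_orbit_bij[OF p(1) n(1) p(3)]] by blast
    then show ?thesis
      using orbit_eq[of "Suc i"] orbit_eq[of i] by simp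
  next
    case False
    then show ?thesis
      using p(1) q(1) permutes_not_in unfolding cyclic_perm_def by metis
  qed
  then show ?thesis
    using orbit_eq[of 0] by auto
qed

text \<open>Standardisation: realise the word by reals \<open>y i\<close>, replace each by its rank
  \<open>f i\<close>, and let \<open>p\<close> send \<open>f i\<close> to \<open>f (Suc i)\<close>.
  The letters read by position are monotone with the content of \<open>l\<close>, hence equal to
  \<open>l\<close>.\<close>

lemma itinerary_word_surj:
  assumes w: "w \<in> primitive_words n l"
  obtains p x where "cyclic_perm n p" "block_monotone n s l p" "x \<in> {1..n}"
    "w = (\<lambda>i. l ((p ^^ i) x))"
proof -
  have wmod: "w i = w (i mod n)" for i
    using w by (intro periodic_mod) (simp add: primitive_words_def)
  have bound: "\<bar>w i\<bar> \<le> Max ((\<lambda>i. \<bar>w i\<bar>) ` {..<n})" for i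
    using n wmod[of i] by (intro Max_ge) (auto intro!: image_eqI[of _ _ "i mod n"])
  obtain y where itin: "itinerary r s w y"
    and y_tail: "\<And>i j. y i = y j \<longleftrightarrow> (\<forall>m. w (i + m) = w (j + m))"
    using itinerary_exists[of w, OF bound r s] by blast
  have y_eq: "y i = y j \<longleftrightarrow> i mod n = j mod n" for i j
  proof
    assume "i mod n = j mod n"
    then have "w (i + m) = w (j + m)" for m
      using wmod[of "i + m"] wmod[of "j + m"] by (metis mod_add_left_eq)
    then show "y i = y j" by (simp add: y_tail)
  qed (use primitive_words_tail_eqD[OF w n(1)] y_tail in blast)
  \<comment> \<open>The weak inequality counts the point itself, so ranks start at 1.\<close>
  define f where "f i = card {j \<in> {..<n}. y j \<le> y i}" for i
  have f_le: "f i \<le> f j" if "y i \<le> y j" for i j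
    unfolding f_def using that by (intro card_mono) auto
  have f_less: "f i < f j" if "y i < y j" for i j
    unfolding f_def
  proof (intro psubset_card_mono psubsetI)
    have "y (j mod n) = y j" by (simp add: y_eq)
    then have "j mod n \<in> {k \<in> {..<n}. y k \<le> y j} - {k \<in> {..<n}. y k \<le> y i}"
      using n that by auto
    then show "{k \<in> {..<n}. y k \<le> y i} \<noteq> {k \<in> {..<n}. y k \<le> y j}" by blast
  qed (use that in auto)
  have f_less_iff: "f i < f j \<longleftrightarrow> y i < y j" for i j
    using f_le[of j i] f_less[of i j] by linarith
  have f_eq: "f i = f j \<longleftrightarrow> i mod n = j mod n" for i j
    using f_less_iff[of i j] f_less_iff[of j i] y_eq[of i j] by linarith
  have f_mod: "f (i mod n) = f i" for i by (simp add: f_eq)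
  have f_in: "f i \<in> {1..n}" for i
  proof -
    have "y (i mod n) = y i" by (simp add: y_eq)
    then have "i mod n \<in> {j \<in> {..<n}. y j \<le> y i}" using n by simp
    then have "f i > 0" by (auto simp: f_def card_gt_0_iff)
    moreover have "f i \<le> card {..<n}" unfolding f_def by (intro card_mono) auto
    ultimately show ?thesis by simp
  qed
  have f_inj: "inj_on f {..<n}"
    by (intro inj_onI) (simp add: f_eq)
  have f_img: "f ` {..<n} = {1..n}"
    using f_in f_inj by (intro card_subset_eq) (auto simp: card_image)
  define g where "g = the_inv_into {..<n} f"
  have gf: "g (f i) = i mod n" for i
    using the_inv_into_f_f[OF f_inj, of "i mod n"] n by (simp add: g_def f_mod)
  define p where "p z = (if z \<in> {1..n} then f (Suc (g z)) else z)" for z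
  have pf: "p (f i) = f (Suc i)" for i
    using f_in[of i] by (simp add: p_def gf f_eq mod_Suc_eq)
  have pf_pow: "(p ^^ k) (f i) = f (i + k)" for k i
    by (induction k) (auto simp: pf)
  \<comment> \<open>Indices may be raised by multiples of n. The lower bound \<open>m\<close> leaves
    room to step back by one for a preimage under \<open>p\<close>, or to subtract the index at
    which 1 occurs.\<close>
  have f_onto: "\<exists>i\<ge>m. z = f i" if "z \<in> {1..n}" for z m
  proof -
    from that obtain i where "z = f i" unfolding f_img[symmetric] by blast
    then have "z = f (i + m * n)" by (simp add: f_eq)
    moreover have "m \<le> i + m * n" using n by (simp add: trans_le_add2)
    ultimately show ?thesis by blast
  qed
  have perm: "p permutes {1..n}"
  proof (rule bij_imp_permutes)
    have "p ` {1..n} \<subseteq> {1..n}"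
      using f_in by (auto simp: p_def)
    moreover have sub: "{1..n} \<subseteq> p ` {1..n}"
    proof
      fix z assume "z \<in> {1..n}"
      then obtain i where "i \<ge> 1" "z = f i" using f_onto[of z 1] by blast
      then have "z = p (f (i - 1))" by (simp add: pf)
      then show "z \<in> p ` {1..n}" using f_in by blast
    qed
    ultimately show "bij_betw p {1..n} {1..n}"
      using finite_surj_inj[OF finite_atLeastAtMost sub] by (auto intro!: bij_betw_imageI)
  qed (auto simp: p_def)
  have "{(p ^^ k) 1 | k. True} = {1..n}"
  proof -
    have "1 \<in> {1..n}" using n by simp
    then obtain i where i: "1 = f i" using f_onto by blast
    have pow1: "(p ^^ k) 1 = f (i + k)" for k
      using pf_pow[of k i] i by (simp only:)
    have "(p ^^ k) 1 \<in> {1..n}" for k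
      using f_in[of "i + k"] by (simp only: pow1)
    moreover have "\<exists>k. z = (p ^^ k) 1" if z: "z \<in> {1..n}" for z
    proof -
      obtain j where "j \<ge> i" "z = f j" using f_onto[OF z] by blast
      then have "z = (p ^^ (j - i)) 1" by (simp only: pow1) simp
      then show ?thesis by blast
    qed
    ultimately show ?thesis by blast
  qed
  then have cyc: "cyclic_perm n p" using perm by (simp add: cyclic_perm_def)
  have w_le: "r * w i \<le> r * w j" if "f i < f j" for i j
    using itin that unfolding f_less_iff itinerary_def by (meson less_asym not_le)
  have wg: "w (g (f i)) = w i" for i
    using wmod[of i] by (simp add: gf)
  have "w (g z) = l z" if "z \<in> {1..n}" for z
  proof (rule monotone_content_unique[OF r _ mono _ that])
    fix a b assume ab: "1 \<le> a" "a < b" "b \<le> n"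
    then obtain i j where "a = f i" "b = f j"
      using f_onto[of a 0] f_onto[of b 0] by auto
    then show "r * w (g a) \<le> r * w (g b)" using w_le ab by (simp add: wg)
  next
    have "image_mset (\<lambda>z. w (g z)) (mset_set {1..n}) =
        image_mset (\<lambda>z. w (g z)) (image_mset f (mset_set {..<n}))"
      by (simp only: image_mset_mset_set[OF f_inj] f_img)
    also have "\<dots> = image_mset w (mset_set {..<n})"
      by (simp add: multiset.map_comp comp_def wg)
    finally show "image_mset (\<lambda>z. w (g z)) (mset_set {1..n}) = image_mset l (mset_set {1..n})"
      using w by (simp add: primitive_words_def)
  qed
  then have lf: "l (f i) = w i" for i using f_in wg by metis
  have "block_monotone n s l p"
    unfolding block_monotone_def
  proof (intro allI impI, elim conjE)
    fix a b assume ab: "1 \<le> a" "a < b" "b \<le> n" "l a = l b"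
    then obtain i j where ij: "a = f i" "b = f j"
      using f_onto[of a 0] f_onto[of b 0] by auto
    then have "w i = w j" "y i < y j" using ab by (simp_all add: lf f_less_iff)
    then have "s * y (Suc i) < s * y (Suc j)"
      using itin unfolding itinerary_def by blast
    then show "s * real (p a) < s * real (p b)"
      unfolding ij pf using s by (auto simp: f_less_iff)
  qed
  moreover have "w = (\<lambda>i. l ((p ^^ i) (f 0)))"
    by (simp add: pf_pow lf)
  ultimately show thesis using that cyc f_in by blast
qed

text \<open>The factor \<open>n\<close> counts the starting points. The right-hand side depends on
  \<open>l\<close> only through its multiset of values and not on \<open>s\<close>, which makes
  increasing and decreasing blocks comparable.\<close>

lemma card_block_monotone_cyclic:
  "card {p. cyclic_perm n p \<and> block_monotone n s l p} * n = card (primitive_words n l)"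
proof -
  let ?A = "{p. cyclic_perm n p \<and> block_monotone n s l p}"
  have "bij_betw (\<lambda>(p, x) i. l ((p ^^ i) x)) (?A \<times> {1..n}) (primitive_words n l)"
    unfolding bij_betw_def
  proof (intro conjI equalityI subsetI inj_onI)
    fix a b assume ab: "a \<in> ?A \<times> {1..n}" "b \<in> ?A \<times> {1..n}"
      "(case a of (p, x) \<Rightarrow> \<lambda>i. l ((p ^^ i) x)) = (case b of (p, x) \<Rightarrow> \<lambda>i. l ((p ^^ i) x))"
    obtain p x q z where "a = (p, x)" "b = (q, z)" by fastforce
    then show "a = b"
      using ab itinerary_word_inj[of p x q z] by simp
  next
    fix w assume "w \<in> (\<lambda>(p, x) i. l ((p ^^ i) x)) ` (?A \<times> {1..n})"
    then show "w \<in> primitive_words n l"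
      using itinerary_word_in_primitive_words by auto
  next
    fix w assume "w \<in> primitive_words n l"
    then obtain p x where "cyclic_perm n p" "block_monotone n s l p" "x \<in> {1..n}"
      "w = (\<lambda>i. l ((p ^^ i) x))"
      by (rule itinerary_word_surj)
    then show "w \<in> (\<lambda>(p, x) i. l ((p ^^ i) x)) ` (?A \<times> {1..n})"
      by (intro image_eqI[of _ _ "(p, x)"]) auto
  qed
  from bij_betw_same_card[OF this] show ?thesis
    by (simp add: card_cartesian_product)
qed

end


subsection \<open>Descent sets\<close>

definition descents :: "nat \<Rightarrow> (nat \<Rightarrow> nat) \<Rightarrow> nat set" where
  "descents n p = {i \<in> {1..<n}. p (Suc i) < p i}"

lemma segment_chain_iff:
  fixes lo hi :: nat
  assumes trans: "\<And>x y z. R x y \<Longrightarrow> R y z \<Longrightarrow> R x z"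
  shows "(\<forall>a b. lo < a \<and> a < b \<and> b \<le> hi \<longrightarrow> R (p a) (p b)) \<longleftrightarrow>
    (\<forall>i. lo < i \<and> i < hi \<longrightarrow> R (p i) (p (Suc i)))"
proof (intro iffI allI impI)
  fix a b assume step: "\<forall>i. lo < i \<and> i < hi \<longrightarrow> R (p i) (p (Suc i))"
    and ab: "lo < a \<and> a < b \<and> b \<le> hi"
  then have "Suc a \<le> b" by simp
  then have "b \<le> hi \<longrightarrow> R (p a) (p b)"
  proof (induction rule: dec_induct)
    case base
    then show ?case using step ab by simp
  next
    case (step k)
    then show ?case
      using \<open>\<forall>i. lo < i \<and> i < hi \<longrightarrow> R (p i) (p (Suc i))\<close> ab trans[of "p a" "p k" "p (Suc k)"]
      by simp
  qed
  then show "R (p a) (p b)" using ab by simp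
qed simp

lemma descents_not_mem_iff:
  assumes "inj_on p {1..n}" "1 \<le> i" "i < n"
  shows "i \<notin> descents n p \<longleftrightarrow> p i < p (Suc i)"
proof -
  have "p i \<noteq> p (Suc i)"
    using assms inj_onD[OF assms(1), of i "Suc i"] by auto
  then show ?thesis using assms by (auto simp: descents_def)
qed

text \<open>\<open>card {t \<in> S. t < a}\<close> numbers the block containing \<open>a\<close>: it
  jumps just after each element of \<open>S\<close>, so neighbours \<open>i\<close> and
  \<open>Suc i\<close> share a block iff \<open>i \<notin> S\<close>.\<close>

lemma increasing_on_blocks_iff_descents_subset:
  assumes S: "finite S" and inj: "inj_on p {1..n}"
  shows "(\<forall>a b. 1 \<le> a \<and> a < b \<and> b \<le> n \<and> card {t \<in> S. t < a} = card {t \<in> S. t < b} \<longrightarrow> p a < p b)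
    \<longleftrightarrow> descents n p \<subseteq> S" (is "?L \<longleftrightarrow> ?R")
proof
  assume ?L
  show ?R
  proof
    fix i assume i: "i \<in> descents n p"
    show "i \<in> S"
    proof (rule ccontr)
      assume "i \<notin> S"
      then have "{t \<in> S. t < i} = {t \<in> S. t < Suc i}"
        by (auto simp: less_Suc_eq)
      then have "p i < p (Suc i)"
        using \<open>?L\<close> i by (auto simp: descents_def)
      then show False using i by (simp add: descents_def)
    qed
  qed
next
  assume ?R
  show ?L
  proof (intro allI impI, elim conjE)
    fix a b assume ab: "1 \<le> a" "a < b" "b \<le> n" "card {t \<in> S. t < a} = card {t \<in> S. t < b}"
    \<comment> \<open>One set contains the other, so equal cardinalities make them equal: no element
      of \<open>S\<close> lies in \<open>{a..<b}\<close>.\<close>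
    then have eq: "{t \<in> S. t < a} = {t \<in> S. t < b}"
      using S by (intro card_subset_eq) auto
    have "p i < p (Suc i)" if "a - 1 < i" "i < b" for i
    proof -
      have "i \<notin> S"
      proof
        assume "i \<in> S"
        then have "i \<in> {t \<in> S. t < a}" unfolding eq using that by simp
        then have "i < a" by simp
        then show False using that by linarith
      qed
      then show ?thesis
        using descents_not_mem_iff[OF inj, of i] that ab \<open>?R\<close> by auto
    qed
    then have "\<forall>x y. a - 1 < x \<and> x < y \<and> y \<le> b \<longrightarrow> p x < p y"
      by (subst segment_chain_iff) auto
    then show "p a < p b" using ab by auto
  qed
qed

lemma finite_cyclic_perms: "finite {p. cyclic_perm n p}"
  by (rule finite_subset[OF _ finite_permutations[of "{1..n}"]]) (auto simp: cyclic_perm_def)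

section \<open>Position reversal and the transfer to signature classes\<close>

definition flip :: "nat \<Rightarrow> nat \<Rightarrow> nat" where
  "flip n i = Suc n - i"

lemma bij_betw_flip: "bij_betw (flip n) {1..n} {1..n}"
  by (rule bij_betwI[where g = "flip n"]) (auto simp: flip_def)

lemma inj_on_comp_flip: "p permutes {1..n} \<Longrightarrow> inj_on (p \<circ> flip n) {1..n}"
  using bij_betw_flip[of n]
  by (intro comp_inj_on) (auto simp: bij_betw_def permutes_inj_on)

text \<open>Multiplied by \<open>n\<close>, both sides count the same words: the block labels
  \<open>l\<close> with increasing blocks, and the reversed labels \<open>l \<circ> flip n\<close>
  with decreasing blocks, have the same content.\<close>

lemma card_cyclic_descents_subset:
  assumes n: "n \<ge> 1" "n mod 4 \<noteq> 2" and "finite S"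
  shows "card {p. cyclic_perm n p \<and> descents n p \<subseteq> S} =
    card {p. cyclic_perm n p \<and> descents n (p \<circ> flip n) \<subseteq> S}"
proof -
  define l where "l x = int (card {t \<in> S. t < x})" for x
  have l_mono: "l a \<le> l b" if "a \<le> b" for a b
    using that \<open>finite S\<close> by (auto simp: l_def intro!: card_mono)
  have words: "primitive_words n (l \<circ> flip n) = primitive_words n l"
  proof -
    have "image_mset (flip n) (mset_set {1..n}) = mset_set {1..n}"
      using bij_betw_flip[of n] image_mset_mset_set[of "flip n" "{1..n}"] by (simp add: bij_betw_def)
    then have "image_mset (l \<circ> flip n) (mset_set {1..n}) = image_mset l (mset_set {1..n})"
      by (metis multiset.map_comp)
    then show ?thesis by (simp add: primitive_words_def)
  qed
  have up: "block_monotone n 1 l p \<longleftrightarrow> descents n p \<subseteq> S" if "cyclic_perm n p" for p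
  proof -
    have "inj_on p {1..n}" using that permutes_inj_on by (auto simp: cyclic_perm_def)
    from increasing_on_blocks_iff_descents_subset[OF \<open>finite S\<close> this]
    show ?thesis by (simp add: block_monotone_def l_def)
  qed
  \<comment> \<open>\<open>flip n\<close> reverses the order of positions, so decreasing on the
    reversed blocks means that \<open>p \<circ> flip n\<close> increases on the blocks of
    \<open>l\<close>.\<close>
  have down: "block_monotone n (-1) (l \<circ> flip n) p \<longleftrightarrow> descents n (p \<circ> flip n) \<subseteq> S"
    if "cyclic_perm n p" for p
  proof -
    have "inj_on (p \<circ> flip n) {1..n}"
      using that by (intro inj_on_comp_flip) (simp add: cyclic_perm_def)
    note * = increasing_on_blocks_iff_descents_subset[OF \<open>finite S\<close> this]
    have flip: "1 \<le> flip n b" "flip n b < flip n a" "flip n a \<le> n" "flip n (flip n a) = a"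
      "flip n (flip n b) = b" if "1 \<le> a" "a < b" "b \<le> n" for a b
      using that by (auto simp: flip_def)
    have "block_monotone n (-1) (l \<circ> flip n) p \<longleftrightarrow>
      (\<forall>a b. 1 \<le> a \<and> a < b \<and> b \<le> n \<and> l a = l b \<longrightarrow> p (flip n a) < p (flip n b))" (is "_ \<longleftrightarrow> ?R")
    proof
      assume L: "block_monotone n (-1) (l \<circ> flip n) p"
      show ?R
      proof (intro allI impI, elim conjE)
        fix a b assume ab: "1 \<le> a" "a < b" "b \<le> n" "l a = l b"
        then show "p (flip n a) < p (flip n b)"
          using L[unfolded block_monotone_def, rule_format, of "flip n b" "flip n a"] flip[OF ab(1-3)]
          by simp
      qed
    next
      assume R: ?R
      show "block_monotone n (-1) (l \<circ> flip n) p"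
        unfolding block_monotone_def
      proof (intro allI impI, elim conjE)
        fix a b assume ab: "1 \<le> a" "a < b" "b \<le> n" "(l \<circ> flip n) a = (l \<circ> flip n) b"
        then show "-1 * real (p a) < -1 * real (p b)"
          using R[rule_format, of "flip n b" "flip n a"] flip[OF ab(1-3)] by simp
      qed
    qed
    then show ?thesis using * by (simp add: l_def)
  qed
  have "card {p. cyclic_perm n p \<and> block_monotone n 1 l p} * n = card (primitive_words n l)"
    by (rule card_block_monotone_cyclic[OF n, of 1]) (auto intro: l_mono)
  moreover have "card {p. cyclic_perm n p \<and> block_monotone n (-1) (l \<circ> flip n) p} * n =
      card (primitive_words n (l \<circ> flip n))"
    by (rule card_block_monotone_cyclic[OF n, of "-1"]) (auto intro!: l_mono simp: flip_def)
  moreover have "n \<noteq> 0" using n by simp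
  ultimately have "card {p. cyclic_perm n p \<and> block_monotone n 1 l p} =
      card {p. cyclic_perm n p \<and> block_monotone n (-1) (l \<circ> flip n) p}"
    unfolding words by (metis mult_cancel2)
  moreover have "{p. cyclic_perm n p \<and> block_monotone n 1 l p} =
      {p. cyclic_perm n p \<and> descents n p \<subseteq> S}"
    using up by blast
  moreover have "{p. cyclic_perm n p \<and> block_monotone n (-1) (l \<circ> flip n) p} =
      {p. cyclic_perm n p \<and> descents n (p \<circ> flip n) \<subseteq> S}"
    using down by blast
  ultimately show ?thesis by simp
qed

text \<open>Inversion on the subset lattice: the number of x with value exactly \<open>S\<close> is
  the number with value inside \<open>S\<close> minus those whose value is a proper subset, equal
  for \<open>f\<close> and \<open>g\<close> by induction. Summing over the sets satisfying
  \<open>Q\<close> gives the claim.\<close>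

lemma card_eq_of_card_subset_eq:
  fixes f g :: "'a \<Rightarrow> 'b set"
  assumes C: "finite C" and U: "finite U" and sub: "\<And>x. x \<in> C \<Longrightarrow> f x \<subseteq> U" "\<And>x. x \<in> C \<Longrightarrow> g x \<subseteq> U"
    and eq: "\<And>S. S \<subseteq> U \<Longrightarrow> card {x \<in> C. f x \<subseteq> S} = card {x \<in> C. g x \<subseteq> S}"
  shows "card {x \<in> C. Q (f x)} = card {x \<in> C. Q (g x)}"
proof -
  have fibres: "card {x \<in> C. h x \<in> F} = (\<Sum>T\<in>F. card {x \<in> C. h x = T})"
    if "finite F" for F and h :: "'a \<Rightarrow> 'b set"
  proof -
    have "{x \<in> C. h x \<in> F} = (\<Union>T\<in>F. {x \<in> C. h x = T})" by auto
    also have "card \<dots> = (\<Sum>T\<in>F. card {x \<in> C. h x = T})"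
      using that C by (intro card_UN_disjoint) auto
    finally show ?thesis .
  qed
  have exact: "card {x \<in> C. f x = S} = card {x \<in> C. g x = S}" if "S \<subseteq> U" for S
    using finite_subset[OF that U] that
  proof (induction S rule: finite_psubset_induct)
    case (psubset S)
    have split: "card {x \<in> C. h x \<subseteq> S} =
        card {x \<in> C. h x = S} + (\<Sum>T\<in>Pow S - {S}. card {x \<in> C. h x = T})" for h :: "'a \<Rightarrow> 'b set"
      using fibres[of "Pow S" h] psubset.hyps sum.remove[of "Pow S" S "\<lambda>T. card {x \<in> C. h x = T}"]
      by simp
    have "(\<Sum>T\<in>Pow S - {S}. card {x \<in> C. f x = T}) = (\<Sum>T\<in>Pow S - {S}. card {x \<in> C. g x = T})"
      using psubset by (intro sum.cong) auto
    then show ?case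
      using split[of f] split[of g] eq[OF psubset.prems] by simp
  qed
  have "{x \<in> C. Q (h x)} = {x \<in> C. h x \<in> {T \<in> Pow U. Q T}}"
    if "\<And>x. x \<in> C \<Longrightarrow> h x \<subseteq> U" for h
    using that by auto
  then have "card {x \<in> C. Q (h x)} = (\<Sum>T\<in>{T \<in> Pow U. Q T}. card {x \<in> C. h x = T})"
    if "\<And>x. x \<in> C \<Longrightarrow> h x \<subseteq> U" for h
    using that U fibres[of "{T \<in> Pow U. Q T}" h] by simp
  then show ?thesis
    using sub exact by simp
qed

text \<open>Within a segment monotonicity is a condition on neighbours only. The pairs starting at
  \<open>e1\<close> or \<open>e2\<close> straddle two segments, so these two indices stay
  unconstrained.\<close>

lemma in_sig_class_3:
  assumes p: "p permutes {1..n}"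
  shows "in_sig_class [s0, s1, s2] n p \<longleftrightarrow>
    (\<exists>e1 e2. e1 \<le> e2 \<and> e2 \<le> n \<and> (\<forall>i. 0 < i \<and> i < n \<longrightarrow>
      (i < e1 \<longrightarrow> (i \<notin> descents n p \<longleftrightarrow> s0)) \<and> (e1 < i \<and> i < e2 \<longrightarrow> (i \<notin> descents n p \<longleftrightarrow> s1)) \<and>
      (e2 < i \<longrightarrow> (i \<notin> descents n p \<longleftrightarrow> s2))))"
proof -
  have inj: "inj_on p {1..n}" using p by (rule permutes_inj_on)
  have segment: "(\<forall>a b. lo < a \<and> a < b \<and> b \<le> hi \<longrightarrow> (if t then p a < p b else p a > p b)) \<longleftrightarrow>
      (\<forall>i. lo < i \<and> i < hi \<longrightarrow> (i \<notin> descents n p \<longleftrightarrow> t))" if "hi \<le> n" for lo hi t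
  proof -
    have "(\<forall>a b. lo < a \<and> a < b \<and> b \<le> hi \<longrightarrow> (if t then p a < p b else p a > p b)) \<longleftrightarrow>
      (\<forall>i. lo < i \<and> i < hi \<longrightarrow> (if t then p i < p (Suc i) else p i > p (Suc i)))"
      by (rule segment_chain_iff) (auto split: if_splits)
    also have "\<dots> \<longleftrightarrow> (\<forall>i. lo < i \<and> i < hi \<longrightarrow> (i \<notin> descents n p \<longleftrightarrow> t))"
    proof -
      have "(if t then p i < p (Suc i) else p i > p (Suc i)) \<longleftrightarrow> (i \<notin> descents n p \<longleftrightarrow> t)"
        if "lo < i" "i < hi" for i
        using descents_not_mem_iff[OF inj, of i] that \<open>hi \<le> n\<close> by (auto simp: descents_def)
      then show ?thesis by blast
    qed
    finally show ?thesis .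
  qed
  let ?seg = "\<lambda>t lo hi. \<forall>a b. lo < a \<and> a < b \<and> b \<le> hi \<longrightarrow> (if t then p a < p b else p a > p b)"
  have all3: "(\<forall>i < length [s0, s1, s2]. P i) \<longleftrightarrow> P 0 \<and> P 1 \<and> P 2" for P
    by (auto simp: less_Suc_eq numeral_2_eq_2)
  have "in_sig_class [s0, s1, s2] n p \<longleftrightarrow>
    (\<exists>e1 e2. e1 \<le> e2 \<and> e2 \<le> n \<and> ?seg s0 0 e1 \<and> ?seg s1 e1 e2 \<and> ?seg s2 e2 n)" (is "?L \<longleftrightarrow> ?R")
  proof
    assume ?L
    then obtain e where "e 0 = 0" "e 3 = n" "e 0 \<le> e (Suc 0)" "e 1 \<le> e (Suc 1)" "e 2 \<le> e (Suc 2)"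
      "?seg ([s0, s1, s2] ! 0) (e 0) (e (Suc 0))" "?seg ([s0, s1, s2] ! 1) (e 1) (e (Suc 1))"
      "?seg ([s0, s1, s2] ! 2) (e 2) (e (Suc 2))"
      unfolding in_sig_class_def all3 by (auto simp: numeral_3_eq_3)
    then show ?R
      by (intro exI[of _ "e 1"] exI[of _ "e 2"]) (simp add: numeral_2_eq_2 numeral_3_eq_3)
  next
    assume ?R
    then obtain e1 e2 where e: "e1 \<le> e2" "e2 \<le> n" "?seg s0 0 e1" "?seg s1 e1 e2" "?seg s2 e2 n"
      by blast
    show ?L
      unfolding in_sig_class_def all3
      by (intro conjI p exI[of _ "\<lambda>i. [0, e1, e2, n] ! i"])
        (use e in \<open>simp_all add: numeral_2_eq_2\<close>)
  qed
  also have "\<dots> \<longleftrightarrow> (\<exists>e1 e2. e1 \<le> e2 \<and> e2 \<le> n \<and> (\<forall>i. 0 < i \<and> i < n \<longrightarrow>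
      (i < e1 \<longrightarrow> (i \<notin> descents n p \<longleftrightarrow> s0)) \<and> (e1 < i \<and> i < e2 \<longrightarrow> (i \<notin> descents n p \<longleftrightarrow> s1)) \<and>
      (e2 < i \<longrightarrow> (i \<notin> descents n p \<longleftrightarrow> s2))))"
  proof (intro iff_exI conj_cong refl)
    fix e1 e2 assume "e1 \<le> e2" "e2 \<le> n"
    then show "?seg s0 0 e1 \<and> ?seg s1 e1 e2 \<and> ?seg s2 e2 n \<longleftrightarrow> (\<forall>i. 0 < i \<and> i < n \<longrightarrow>
      (i < e1 \<longrightarrow> (i \<notin> descents n p \<longleftrightarrow> s0)) \<and> (e1 < i \<and> i < e2 \<longrightarrow> (i \<notin> descents n p \<longleftrightarrow> s1)) \<and>
      (e2 < i \<longrightarrow> (i \<notin> descents n p \<longleftrightarrow> s2)))"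
      by (subst (1 2 3) segment) auto
  qed
  finally show ?thesis .
qed

text \<open>Reversal turns the neighbours i, i + 1 into n + 1 - i, n - i: gap i becomes gap n - i,
  traversed backwards.\<close>

lemma mem_descents_comp_flip_iff:
  assumes "p permutes {1..n}" "0 < i" "i < n"
  shows "i \<in> descents n (p \<circ> flip n) \<longleftrightarrow> n - i \<notin> descents n p"
  using descents_not_mem_iff[of p n "n - i"] permutes_inj_on[OF assms(1)] assms(2,3)
  by (simp add: descents_def flip_def Suc_diff_le Suc_le_eq)

theorem theorem5p2:
  fixes n :: nat
  assumes "n \<ge> 1" and "n mod 4 \<noteq> 2"
  shows "card (cyc_class [True, True, False] n) = card (cyc_class [True, False, False] n)"
proof -
  \<comment> \<open>\<open>Q\<close> is the shape ++- as a property of the descent set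
    alone.\<close>
  define Q where "Q T \<longleftrightarrow> (\<exists>e1 e2. e1 \<le> e2 \<and> e2 \<le> n \<and> (\<forall>i. 0 < i \<and> i < n \<longrightarrow>
      (i < e1 \<longrightarrow> i \<notin> T) \<and> (e1 < i \<and> i < e2 \<longrightarrow> i \<notin> T) \<and> (e2 < i \<longrightarrow> i \<in> T)))" for T
  have Q1: "in_sig_class [True, True, False] n p \<longleftrightarrow> Q (descents n p)" if "cyclic_perm n p" for p
    using that in_sig_class_3[of p n True True False] by (simp add: cyclic_perm_def Q_def)
  have Q2: "in_sig_class [True, False, False] n p \<longleftrightarrow> Q (descents n (p \<circ> flip n))"
    if "cyclic_perm n p" for p
  proof -
    have p: "p permutes {1..n}" using that by (simp add: cyclic_perm_def)
    note flip = mem_descents_comp_flip_iff[OF p]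
    let ?D = "descents n p" and ?E = "descents n (p \<circ> flip n)"
    have "in_sig_class [True, False, False] n p \<longleftrightarrow>
      (\<exists>e1 e2. e1 \<le> e2 \<and> e2 \<le> n \<and> (\<forall>i. 0 < i \<and> i < n \<longrightarrow>
        (i < e1 \<longrightarrow> i \<notin> ?D) \<and> (e1 < i \<and> i < e2 \<longrightarrow> i \<in> ?D) \<and> (e2 < i \<longrightarrow> i \<in> ?D)))"
      using in_sig_class_3[OF p, of True False False] by simp
    also have "\<dots> \<longleftrightarrow> Q ?E"
    proof
      assume "\<exists>e1 e2. e1 \<le> e2 \<and> e2 \<le> n \<and> (\<forall>i. 0 < i \<and> i < n \<longrightarrow>
        (i < e1 \<longrightarrow> i \<notin> ?D) \<and> (e1 < i \<and> i < e2 \<longrightarrow> i \<in> ?D) \<and> (e2 < i \<longrightarrow> i \<in> ?D))"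
      then obtain e1 e2 where e: "e1 \<le> e2" "e2 \<le> n"
        and D: "\<And>i. 0 < i \<Longrightarrow> i < n \<Longrightarrow>
          (i < e1 \<longrightarrow> i \<notin> ?D) \<and> (e1 < i \<and> i < e2 \<longrightarrow> i \<in> ?D) \<and> (e2 < i \<longrightarrow> i \<in> ?D)"
        by blast
      \<comment> \<open>Read backwards, +-- reverses its segments and swaps its signs, giving ++-;
        the cuts \<open>e1\<close>, \<open>e2\<close> become \<open>n - e2\<close>,
        \<open>n - e1\<close>.\<close>
      have "(i < n - e2 \<longrightarrow> i \<notin> ?E) \<and> (n - e2 < i \<and> i < n - e1 \<longrightarrow> i \<notin> ?E) \<and>
          (n - e1 < i \<longrightarrow> i \<in> ?E)" if "0 < i" "i < n" for i
        using D[of "n - i"] flip[of i] that e by auto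
      moreover have "n - e2 \<le> n - e1" "n - e1 \<le> n" using e by auto
      ultimately show "Q ?E" unfolding Q_def by blast
    next
      assume "Q ?E"
      then obtain e1 e2 where e: "e1 \<le> e2" "e2 \<le> n"
        and E: "\<And>i. 0 < i \<Longrightarrow> i < n \<Longrightarrow>
          (i < e1 \<longrightarrow> i \<notin> ?E) \<and> (e1 < i \<and> i < e2 \<longrightarrow> i \<notin> ?E) \<and> (e2 < i \<longrightarrow> i \<in> ?E)"
        unfolding Q_def by blast
      have "(i < n - e2 \<longrightarrow> i \<notin> ?D) \<and> (n - e2 < i \<and> i < n - e1 \<longrightarrow> i \<in> ?D) \<and>
          (n - e1 < i \<longrightarrow> i \<in> ?D)" if "0 < i" "i < n" for i
        using E[of "n - i"] flip[of "n - i"] that e by auto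
      moreover have "n - e2 \<le> n - e1" "n - e1 \<le> n" using e by auto
      ultimately show "\<exists>e1 e2. e1 \<le> e2 \<and> e2 \<le> n \<and> (\<forall>i. 0 < i \<and> i < n \<longrightarrow>
        (i < e1 \<longrightarrow> i \<notin> ?D) \<and> (e1 < i \<and> i < e2 \<longrightarrow> i \<in> ?D) \<and> (e2 < i \<longrightarrow> i \<in> ?D))"
        by blast
    qed
    finally show ?thesis .
  qed
  \<comment> \<open>Both classes are now the same property \<open>Q\<close> of two set-valued
    statistics whose subset counts agree.\<close>
  have "card {p \<in> {p. cyclic_perm n p}. Q (descents n p)} =
      card {p \<in> {p. cyclic_perm n p}. Q (descents n (p \<circ> flip n))}"
  proof (rule card_eq_of_card_subset_eq[OF finite_cyclic_perms, of "{1..<n}"])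
    fix S assume "S \<subseteq> {1..<n}"
    then show "card {p \<in> {p. cyclic_perm n p}. descents n p \<subseteq> S} =
        card {p \<in> {p. cyclic_perm n p}. descents n (p \<circ> flip n) \<subseteq> S}"
      using card_cyclic_descents_subset[OF assms finite_subset] by auto
  qed (auto simp: descents_def)
  moreover have "cyc_class [True, True, False] n = {p \<in> {p. cyclic_perm n p}. Q (descents n p)}"
    using Q1 by (auto simp: cyc_class_def)
  moreover have "cyc_class [True, False, False] n =
      {p \<in> {p. cyclic_perm n p}. Q (descents n (p \<circ> flip n))}"
    using Q2 by (auto simp: cyc_class_def)
  ultimately show ?thesis by simp
qed

end
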